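(* For all $n\ge1$, $$H_n\big((2^{2k}-1)B_{2k}\big)=\frac{(-1)^n}{n!(n+1)!}\cdot\mathcal{H}_n\cdot H_n\big((2^{2k+2}-1)B_{2k+2}\big),$$ where $B_j$ are the Bernoulli numbers and $\mathcal{H}_n:=\sum_{j=1}^n\frac1j$.
   Context: For a sequence $(a_k)_{k\ge 0}$ and $n\ge 0$, $H_n(a_k):=\det(a_{i+j})_{0\le i,j\le n}$ denotes the $(n+1)\times(n+1)$ Hankel determinant; in the claim the sequences are indexed by $k\ge0$. The Bernoulli numbers are defined by $\frac{t}{e^t-1}=\sum_{n\ge0}B_n\frac{t^n}{n!}$. *)

theory Defs
  imports
    "HOL-Computational_Algebra.Formal_Power_Series"
    "HOL-Analysis.Harmonic_Numbers"
    "Jordan_Normal_Form.Determinant"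
begin

text \<open>
  The quotient is that of formal power series over a field, which cancels the common
  factor \<open>fps_X\<close>; it is a genuine quotient by \<open>bernoulli_egf\<close> below.
\<close>

definition bernoulli :: "nat \<Rightarrow> real" where
  "bernoulli n = fact n * fps_nth (fps_X / (fps_exp 1 - 1)) n"

lemma bernoulli_egf:
  "Abs_fps (\<lambda>n. bernoulli n / fact n) * (fps_exp 1 - 1) = fps_X"
proof -
  have "Abs_fps (\<lambda>n. bernoulli n / fact n) = fps_X / (fps_exp 1 - 1)"
    by (simp add: fps_eq_iff bernoulli_def)
  moreover have "subdegree (fps_exp (1::real) - 1) = 1"
    by (rule subdegreeI) auto
  hence "fps_exp (1::real) - 1 dvd fps_X"
    by (subst fps_dvd_iff) auto
  ultimately show ?thesis by simp
qed

definition hankel_det :: "(nat \<Rightarrow> real) \<Rightarrow> nat \<Rightarrow> real" where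
  "hankel_det a n = Determinant.det (mat (n + 1) (n + 1) (\<lambda>(i, j). a (i + j)))"

end

theory Submission
  imports Defs
begin

text \<open>
  Let \<open>M\<close> be the functional on polynomials with moments \<open>M (x ^ k) = (2\<^sup>2\<^sup>k - 1) B\<^sub>2\<^sub>k\<close> and
  put \<open>L (q) = M (x q)\<close>, so that the two determinants are the Hankel determinants of \<open>M\<close> and
  \<open>L\<close>. The monic orthogonal polynomials of \<open>L\<close> are the continuous dual Hahn polynomials
  \<open>p\<^sub>n = n!\<^sup>2 (\<Sum>k\<le>n. (n choose k) / k!\<^sup>2 (\<Prod>j<k. x - j\<^sup>2))\<close>: with \<open>S\<^sub>j = (\<Prod>i=1..j. x - i\<^sup>2)\<close> the
  matrix \<open>L (p\<^sub>i S\<^sub>j)\<close> is upper triangular with diagonal entries \<open>h\<^sub>i = i!\<^sup>3 (i + 1)! / 2\<close>.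
  For \<open>M\<close>, use the rows \<open>p\<^sub>0, \<dots>, p\<^sub>n\<close> and the columns \<open>1, x S\<^sub>0, \<dots>, x S\<^sub>n\<^sub>-\<^sub>1\<close>. The last row
  then vanishes outside the first column, and the determinant is
  \<open>(- 1) ^ n M (p\<^sub>n) h\<^sub>0 \<dots> h\<^sub>n\<^sub>-\<^sub>1\<close>, where \<open>M (p\<^sub>n)\<close> is \<open>n!\<^sup>2 / 2\<close> times the harmonic number.
\<close>

section \<open>Moment functionals and Hankel determinants in monic bases\<close>

definition umbral :: "(nat \<Rightarrow> real) \<Rightarrow> real poly \<Rightarrow> real" where
  "umbral a p = (\<Sum>i\<le>degree p. coeff p i * a i)"

lemma umbral_altdef:
  assumes "degree p \<le> m"
  shows "umbral a p = (\<Sum>i\<le>m. coeff p i * a i)"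
  unfolding umbral_def using assms
  by (intro sum.mono_neutral_left) (auto simp: coeff_eq_0)

lemma umbral_0 [simp]: "umbral a 0 = 0"
  by (simp add: umbral_def)

lemma umbral_1 [simp]: "umbral a 1 = a 0"
  by (simp add: umbral_def)

lemma umbral_add: "umbral a (p + q) = umbral a p + umbral a q"
proof -
  define m where "m = max (degree p) (degree q)"
  have "degree p \<le> m" "degree q \<le> m" "degree (p + q) \<le> m"
    by (auto simp: m_def degree_add_le)
  thus ?thesis by (simp add: umbral_altdef[of _ m] sum.distrib algebra_simps)
qed

lemma umbral_smult: "umbral a (smult c p) = c * umbral a p"
  by (simp add: umbral_altdef[of _ "degree p"] sum_distrib_left algebra_simps)

lemma umbral_sum: "umbral a (\<Sum>x\<in>A. f x) = (\<Sum>x\<in>A. umbral a (f x))"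
  by (induction A rule: infinite_finite_induct) (simp_all add: umbral_add)

lemma umbral_monom: "umbral a (monom c k) = c * a k"
  by (subst umbral_altdef[of _ k])
    (simp_all add: degree_monom_le if_distrib[where f = "\<lambda>x. x * _"] cong: if_cong)

lemma umbral_pCons: "umbral a (pCons c p) = c * a 0 + umbral (\<lambda>k. a (Suc k)) p"
  by (subst umbral_altdef[of _ "Suc (degree p)"])
    (simp_all add: degree_pCons_le umbral_def sum.atMost_Suc_shift del: sum.atMost_Suc)

lemma umbral_mult:
  assumes "degree p \<le> m" "degree q \<le> m'"
  shows "umbral a (p * q) = (\<Sum>k\<le>m. \<Sum>l\<le>m'. coeff p k * coeff q l * a (k + l))"
proof -
  have "p * q = (\<Sum>k\<le>m. monom (coeff p k) k) * (\<Sum>l\<le>m'. monom (coeff q l) l)"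
    by (simp add: poly_as_sum_of_monoms' assms)
  also have "\<dots> = (\<Sum>k\<le>m. \<Sum>l\<le>m'. monom (coeff p k * coeff q l) (k + l))"
    by (simp add: sum_product mult_monom)
  finally show ?thesis by (simp add: umbral_sum umbral_monom)
qed

lemma det_triangular_monic:
  assumes "\<And>i. degree (u i) \<le> i" "\<And>i. coeff (u i) i = (1 :: real)"
  shows "Determinant.det (mat n n (\<lambda>(i, j). coeff (u i) j)) = 1"
proof -
  have "Determinant.det (mat n n (\<lambda>(i, j). coeff (u i) j)) =
      prod_list (diag_mat (mat n n (\<lambda>(i, j). coeff (u i) j)))"
    by (rule det_lower_triangular[of n])
      (use assms(1) in \<open>auto intro!: coeff_eq_0 intro: le_less_trans\<close>)
  also have "\<dots> = 1"
    by (simp add: prod_list_diag_prod assms(2))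
  finally show ?thesis .
qed

text \<open>Changing from monomials to monic bases multiplies the Hankel matrix on both sides by
  unitriangular coefficient matrices, as \<open>U * (H * transpose_mat V)\<close>, which preserves
  the determinant.\<close>

lemma hankel_det_conv_umbral:
  assumes u: "\<And>i. degree (u i) \<le> i" "\<And>i. coeff (u i) i = (1 :: real)"
  assumes v: "\<And>i. degree (v i) \<le> i" "\<And>i. coeff (v i) i = (1 :: real)"
  shows "hankel_det a n =
    Determinant.det (mat (n + 1) (n + 1) (\<lambda>(i, j). umbral a (u i * v j)))"
proof -
  define U where "U = mat (n + 1) (n + 1) (\<lambda>(i, j). coeff (u i) j)"
  define V where "V = mat (n + 1) (n + 1) (\<lambda>(i, j). coeff (v i) j)"
  define H where "H = mat (n + 1) (n + 1) (\<lambda>(i, j). a (i + j))"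
  have carrier: "U \<in> carrier_mat (n + 1) (n + 1)" "V \<in> carrier_mat (n + 1) (n + 1)"
    "H \<in> carrier_mat (n + 1) (n + 1)"
    by (simp_all add: U_def V_def H_def)
  have "mat (n + 1) (n + 1) (\<lambda>(i, j). umbral a (u i * v j)) = U * (H * transpose_mat V)"
  proof (rule eq_matI)
    fix i j assume "i < dim_row (U * (H * transpose_mat V))" "j < dim_col (U * (H * transpose_mat V))"
    hence ij: "i < n + 1" "j < n + 1" by (simp_all add: U_def V_def)
    have "umbral a (u i * v j) = (\<Sum>k\<le>n. \<Sum>l\<le>n. coeff (u i) k * coeff (v j) l * a (k + l))"
      using ij by (intro umbral_mult) (auto intro: order.trans[OF u(1)] order.trans[OF v(1)])
    also have "\<dots> = (\<Sum>k\<le>n. coeff (u i) k * (\<Sum>l\<le>n. a (k + l) * coeff (v j) l))"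
      by (simp add: sum_distrib_left mult_ac)
    also have "\<dots> = (U * (H * transpose_mat V)) $$ (i, j)"
      using ij by (simp add: U_def V_def H_def scalar_prod_def atLeast0LessThan
          lessThan_Suc_atMost del: sum.lessThan_Suc sum.atMost_Suc)
    finally show "mat (n + 1) (n + 1) (\<lambda>(i, j). umbral a (u i * v j)) $$ (i, j) =
        (U * (H * transpose_mat V)) $$ (i, j)" using ij by simp
  qed (simp_all add: U_def V_def)
  also have "Determinant.det \<dots> = Determinant.det U * (Determinant.det H * Determinant.det V)"
    using carrier by (simp add: det_mult[of _ "n + 1"] det_transpose[of _ "n + 1"])
  finally show ?thesis
    using det_triangular_monic[of u, OF u] det_triangular_monic[of v, OF v]
    by (simp add: hankel_det_def U_def V_def H_def)
qed

section \<open>The Genocchi numbers \<open>- 2 * gbern n\<close> and their functional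
  equation\<close>

definition gbern :: "nat \<Rightarrow> real" where
  "gbern n = (2 ^ n - 1) * bernoulli n"

text \<open>The weights 2^n replace t by 2t, so the series is B(2t) - B(t). Factoring e^(2t) - 1 =
  (e^t - 1)(e^t + 1) gives B(2t)(e^t + 1) = 2 B(t).\<close>

lemma gbern_egf:
  "Abs_fps (\<lambda>n. gbern n / fact n) * (fps_exp 1 + 1) = - fps_X"
proof -
  define B where "B = Abs_fps (\<lambda>n. bernoulli n / fact n)"
  define E where "E = fps_exp (1::real)"
  define B2 where "B2 = fps_compose B (fps_const 2 * fps_X)"
  have B: "B * (E - 1) = fps_X"
    using bernoulli_egf by (simp add: B_def E_def)
  have nz: "E - 1 \<noteq> 0" using B by auto
  have E2: "fps_compose E (fps_const 2 * fps_X) = E * E"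
    by (simp add: E_def fps_exp_add_mult [symmetric])
  have "fps_compose (B * (E - 1)) (fps_const 2 * fps_X) = B2 * (E * E - 1)"
    unfolding B2_def by (subst fps_compose_mult_distrib) (simp_all add: fps_compose_sub_distrib E2)
  hence "B2 * (E * E - 1) = 2 * fps_X"
    by (simp add: B numeral_fps_const)
  hence "(B2 * (E + 1)) * (E - 1) = (2 * B) * (E - 1)"
    by (simp add: B mult.assoc) (simp add: algebra_simps)
  hence B2: "B2 * (E + 1) = 2 * B" using nz by simp
  have "Abs_fps (\<lambda>n. gbern n / fact n) = B2 - B"
    unfolding B2_def fps_compose_linear
    by (simp add: fps_eq_iff gbern_def B_def algebra_simps diff_divide_distrib)
  also have "\<dots> * (E + 1) = - (B * (E - 1))"
    using B2 by (simp add: algebra_simps)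
  finally show ?thesis using B by (simp add: E_def)
qed

lemma gbern_0 [simp]: "gbern 0 = 0"
  by (simp add: gbern_def)

lemma gbern_binomial_sum:
  "(\<Sum>i\<le>n. real (n choose i) * gbern i) + gbern n = (if n = 1 then - 1 else 0)"
proof -
  have "fact n * fps_nth (Abs_fps (\<lambda>n. gbern n / fact n) * (fps_exp 1 + 1)) n =
      (\<Sum>i\<le>n. real (n choose i) * gbern i) + gbern n"
    unfolding distrib_left[of "Abs_fps _"] mult_1_right fps_add_nth fps_mult_nth
    by (simp add: distrib_left[of "fact n"]
        sum_distrib_left binomial_fact atLeast0AtMost algebra_simps)
  thus ?thesis by (subst (asm) gbern_egf) (auto simp: fps_X_nth)
qed

lemma umbral_linear_power:
  "umbral a ([:1, 1:] ^ n) = (\<Sum>i\<le>n. real (n choose i) * a i)"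
proof -
  have "[:1, 1:] = monom (1::real) 1 + 1"
    by (simp add: monom_altdef one_pCons)
  hence "[:1, 1:] ^ n = (\<Sum>i\<le>n. monom (real (n choose i)) i)"
    by (simp add: binomial_ring monom_power of_nat_poly smult_monom)
  thus ?thesis by (simp add: umbral_sum umbral_monom)
qed

text \<open>By linearity it suffices to treat monomials, where this is the recurrence
  \<open>gbern_binomial_sum\<close>.\<close>

lemma umbral_gbern_shift:
  "umbral gbern (pcompose p [:1, 1:]) + umbral gbern p = - coeff p 1"
proof -
  define F where "F p = umbral gbern (pcompose p [:1, 1:]) + umbral gbern p + coeff p 1" for p
  have monom: "F (monom c n) = 0" for c n
  proof -
    have "pcompose (monom c n) [:1, 1:] = smult c ([:1, 1:] ^ n)"
      by (induction n) (simp_all add: monom_0 monom_Suc pcompose_pCons algebra_simps)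
    hence "F (monom c n) = c *
        ((\<Sum>i\<le>n. real (n choose i) * gbern i) + gbern n + (if n = 1 then 1 else 0))"
      by (simp add: F_def umbral_smult umbral_linear_power umbral_monom algebra_simps)
    thus ?thesis by (simp add: gbern_binomial_sum)
  qed
  have "F p = F (\<Sum>i\<le>degree p. monom (coeff p i) i)"
    by (simp add: poly_as_sum_of_monoms)
  also have "\<dots> = (\<Sum>i\<le>degree p. F (monom (coeff p i) i))"
    by (simp add: F_def pcompose_sum umbral_sum coeff_sum sum.distrib del: coeff_monom)
  finally have "F p = 0" by (simp add: monom)
  thus ?thesis by (simp add: F_def)
qed

text \<open>Links the functional of \<open>gbern\<close> in X with that of \<open>gbern_even\<close>
  in x = X^2. Each \<open>pCons\<close> shifts the moments by two, hence the induction over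
  arbitrary \<open>a\<close>.\<close>

lemma umbral_pcompose_square:
  "umbral a (pcompose p [:0, 0, 1:]) = umbral (\<lambda>k. a (2 * k)) p"
  by (induction p arbitrary: a) (simp_all add: pcompose_pCons umbral_add umbral_pCons)

section \<open>Moments of central factorials\<close>

definition gbern_even :: "nat \<Rightarrow> real" where
  "gbern_even k = gbern (2 * k)"

lemma gbern_even_0 [simp]: "gbern_even 0 = 0"
  by (simp add: gbern_even_def)

definition cfact :: "nat \<Rightarrow> nat \<Rightarrow> real poly" where
  "cfact s k = (\<Prod>j<k. [:- (real (s + j))\<^sup>2, 1:])"

lemma cfact_0 [simp]: "cfact s 0 = 1"
  by (simp add: cfact_def)

lemma cfact_Suc: "cfact s (Suc k) = [:- (real (s + k))\<^sup>2, 1:] * cfact s k"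
  by (simp add: cfact_def mult.commute)

lemma degree_cfact [simp]: "degree (cfact s k) = k"
  unfolding cfact_def by (subst degree_prod_eq_sum_degree) auto

lemma coeff_cfact_self [simp]: "coeff (cfact s k) k = 1"
proof -
  have "lead_coeff (cfact s k) = 1"
    unfolding cfact_def by (subst lead_coeff_prod) simp
  thus ?thesis by simp
qed

text \<open>
  With \<open>P = \<Prod>j<k. (X + j) * (X - j - 1)\<close>, the sum \<open>P (X + 1) + P (X)\<close> collapses
  to twice the central factorial, so the functional equation of \<^const>\<open>gbern\<close> evaluates it.
\<close>

lemma umbral_gbern_cfact:
  "umbral gbern_even (cfact 0 (Suc m)) = (- 1) ^ m * fact m * fact (Suc m) / 2"
proof -
  define k where "k = Suc m"
  define U where "U = (\<Prod>j<k. [:real j, 1:])"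
  define V where "V = (\<Prod>j<k. [:- real j, 1:])"
  define U' where "U' = (\<Prod>j<k. [:real (Suc j), 1:])"
  define V' where "V' = (\<Prod>j<k. [:- real (Suc j), 1:])"
  have U': "[:0, 1:] * U' = [:real k, 1:] * U"
    unfolding U_def U'_def using prod.lessThan_Suc_shift[of "\<lambda>j. [:real j, 1:]" k]
    by (simp add: mult.commute)
  have V': "[:0, 1:] * V' = [:- real k, 1:] * V"
    unfolding V_def V'_def using prod.lessThan_Suc_shift[of "\<lambda>j. [:- real j, 1:]" k]
    by (simp add: mult.commute)
  have UV: "U * V = pcompose (cfact 0 k) [:0, 0, 1:]"
    by (simp add: U_def V_def cfact_def pcompose_prod pcompose_pCons power2_eq_square
        flip: prod.distrib)
  have shift: "pcompose (U * V') [:1, 1:] = U' * V"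
    by (simp add: U_def V_def U'_def V'_def pcompose_mult pcompose_prod pcompose_pCons add_ac)
  \<comment> \<open>The factor j = 0 of \<open>U\<close> is X, so the linear coefficient of
    \<open>U * V'\<close> is the value at 0 of the remaining product.\<close>
  have "U = [:0, 1:] * (\<Prod>j<m. [:real (Suc j), 1:])"
    unfolding U_def k_def by (subst prod.lessThan_Suc_shift) simp
  hence "coeff (U * V') 1 = poly (\<Prod>j<m. [:real (Suc j), 1:]) 0 * poly V' 0"
    by (simp add: coeff_pCons coeff_mult_0 poly_0_coeff_0 del: poly_prod)
  also have "poly (\<Prod>j<m. [:real (Suc j), 1:]) 0 = fact m"
    by (simp add: poly_prod fact_prod_Suc atLeast0LessThan)
  also have "poly V' 0 = (- 1) ^ k * fact k"
    unfolding V'_def poly_prod by (induction k) (simp_all add: algebra_simps)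
  finally have coeff: "coeff (U * V') 1 = fact m * ((- 1) ^ k * fact k)" .
  \<comment> \<open>After multiplication by X both terms contain \<open>U * V\<close>, with
    cofactors X + k and X - k adding up to 2X; then X is cancelled.\<close>
  have "[:0, 1:] * (U' * V + U * V') = ([:0, 1:] * U') * V + U * ([:0, 1:] * V')"
    by (simp add: algebra_simps)
  also have "\<dots> = ([:real k, 1:] + [:- real k, 1:]) * (U * V)"
    unfolding U' V' by (simp only: algebra_simps)
  also have "\<dots> = [:0, 1:] * smult 2 (U * V)"
    by simp
  finally have "U' * V + U * V' = smult 2 (U * V)"
    by (simp only: mult_cancel_left) simp
  hence "2 * umbral gbern (U * V) =
      umbral gbern (pcompose (U * V') [:1, 1:]) + umbral gbern (U * V')"
    by (simp add: shift flip: umbral_add umbral_smult)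
  also have "\<dots> = - coeff (U * V') 1"
    by (rule umbral_gbern_shift)
  also note coeff
  finally show ?thesis
    by (simp add: UV umbral_pcompose_square k_def gbern_even_def [abs_def] mult_ac)
qed

text \<open>Writing x - (j+1)^2 = (x - k^2) + (k^2 - (j+1)^2) moves a factor into
  \<open>cfact 0 k\<close>, so the induction on \<open>j\<close> must leave \<open>k\<close>
  arbitrary.\<close>

lemma umbral_gbern'_cfact_mult:
  "umbral (\<lambda>k. gbern_even (Suc k)) (cfact 0 k * cfact (Suc 0) j) =
     (- 1) ^ (k + j) * fact (k + j) * fact k * fact (Suc j) / 2"
proof (induction j arbitrary: k)
  case 0
  have "pCons 0 (cfact 0 k) = cfact 0 (Suc k) + smult ((real k)\<^sup>2) (cfact 0 k)"
    by (simp add: cfact_Suc)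
  hence "umbral (\<lambda>k. gbern_even (Suc k)) (cfact 0 k) = umbral gbern_even (cfact 0 (Suc k)) +
      (real k)\<^sup>2 * umbral gbern_even (cfact 0 k)"
    using umbral_pCons[of gbern_even 0 "cfact 0 k"]
    by (simp add: umbral_add umbral_smult)
  also have "\<dots> = (- 1) ^ k * fact k * fact k / 2"
    \<comment> \<open>\<open>umbral_gbern_cfact\<close> needs a positive length; for k = 0 the
      second term vanishes.\<close>
    by (cases k) (simp_all only: umbral_gbern_cfact, simp_all add: power2_eq_square field_simps)
  finally show ?case by simp
next
  case (Suc j)
  have "cfact 0 k * cfact (Suc 0) (Suc j) = cfact 0 (Suc k) * cfact (Suc 0) j +
      smult ((real k)\<^sup>2 - (real (Suc j))\<^sup>2) (cfact 0 k * cfact (Suc 0) j)"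
    by (simp add: cfact_Suc algebra_simps smult_diff_left)
  hence "umbral (\<lambda>k. gbern_even (Suc k)) (cfact 0 k * cfact (Suc 0) (Suc j)) =
      umbral (\<lambda>k. gbern_even (Suc k)) (cfact 0 (Suc k) * cfact (Suc 0) j) +
      ((real k)\<^sup>2 - (real (Suc j))\<^sup>2) *
      umbral (\<lambda>k. gbern_even (Suc k)) (cfact 0 k * cfact (Suc 0) j)"
    by (simp add: umbral_add umbral_smult)
  also have "\<dots> = (- 1) ^ (k + Suc j) * fact (k + Suc j) * fact k * fact (Suc (Suc j)) / 2"
    \<comment> \<open>Apart from common factors, what remains is (k+1) - (k-j-1) = j+2.\<close>
    unfolding Suc.IH by (simp add: power2_eq_square field_simps)
  finally show ?case .
qed

section \<open>Continuous dual Hahn polynomials: \<open>(fact n)^2\<close> times 3F2(-n, X, -X; 1,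
  1; 1) at x = X^2\<close>

definition dual_hahn :: "nat \<Rightarrow> real poly" where
  "dual_hahn n = (\<Sum>k\<le>n. smult ((fact n)\<^sup>2 * real (n choose k) / (fact k)\<^sup>2) (cfact 0 k))"

lemma degree_dual_hahn: "degree (dual_hahn n) \<le> n"
  unfolding dual_hahn_def by (intro degree_sum_le) auto

lemma coeff_dual_hahn_self: "coeff (dual_hahn n) n = 1"
proof -
  have "coeff (dual_hahn n) n =
      (\<Sum>k\<le>n. if k = n then 1 else 0)"
    unfolding dual_hahn_def coeff_sum by (intro sum.cong) (auto simp: coeff_eq_0)
  thus ?thesis by simp
qed

text \<open>Upper negation absorbs the sign into (-j-1 choose k), Vandermonde sums to (i-j-1 choose
  i), and a second negation returns to (j choose i).\<close>

lemma alternating_binomial_sum: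
  "(\<Sum>k\<le>i. (- 1) ^ k * real (i choose k) * real (k + j choose k)) = (- 1) ^ i * real (j choose i)"
proof -
  have "(\<Sum>k\<le>i. (- 1) ^ k * real (i choose k) * real (k + j choose k)) =
      (\<Sum>k=0..i. (- real j - 1 gchoose k) * (real i gchoose (i - k)))"
  proof (rule sum.cong)
    fix k assume "k \<in> {0..i}"
    hence "real (i choose k) = (real i gchoose (i - k))"
      by (metis atLeastAtMost_iff binomial_gbinomial binomial_symmetric)
    moreover have "(- real j - 1 gchoose k) = (- 1) ^ k * real (k + j choose k)"
      by (subst gbinomial_negated_upper) (simp add: binomial_gbinomial)
    ultimately show "(- 1) ^ k * real (i choose k) * real (k + j choose k) =
      (- real j - 1 gchoose k) * (real i gchoose (i - k))" by simp
  qed auto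
  also have "\<dots> = (- real j - 1 + real i gchoose i)"
    by (rule gbinomial_Vandermonde)
  also have "\<dots> = (- 1) ^ i * real (j choose i)"
    by (subst gbinomial_negated_upper) (simp add: binomial_gbinomial)
  finally show ?thesis .
qed

text \<open>The orthogonality relation: the factor \<open>j choose i\<close> vanishes for j < i. It
  arises because the factorials combine into \<open>k + j choose k\<close>, leaving the preceding
  alternating sum.\<close>

lemma umbral_dual_hahn_mult:
  "umbral (\<lambda>k. gbern_even (Suc k)) (dual_hahn i * cfact (Suc 0) j) =
    (- 1) ^ (i + j) * (fact i)\<^sup>2 * fact j * fact (Suc j) / 2 * real (j choose i)"
proof -
  have "umbral (\<lambda>k. gbern_even (Suc k)) (dual_hahn i * cfact (Suc 0) j) =
      (\<Sum>k\<le>i. (fact i)\<^sup>2 * real (i choose k) / (fact k)\<^sup>2 *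
        ((- 1) ^ (k + j) * fact (k + j) * fact k * fact (Suc j) / 2))"
    by (simp add: dual_hahn_def sum_distrib_right umbral_sum umbral_smult umbral_gbern'_cfact_mult)
  also have "\<dots> = (- 1) ^ j * (fact i)\<^sup>2 * fact j * fact (Suc j) / 2 *
      (\<Sum>k\<le>i. (- 1) ^ k * real (i choose k) * real (k + j choose k))"
    unfolding sum_distrib_left
    by (intro sum.cong) (simp_all add: binomial_fact power_add power2_eq_square field_simps)
  also have "\<dots> = (- 1) ^ (i + j) * (fact i)\<^sup>2 * fact j * fact (Suc j) / 2 * real (j choose i)"
    unfolding alternating_binomial_sum by (simp add: power_add)
  finally show ?thesis .
qed

text \<open>Pascal's rule splits off the sum for \<open>n\<close>; by absorption the rest is 1/(n+1)
  times an alternating row sum without its k = 0 term, which is 1.\<close>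

lemma harm_conv_alternating_sum:
  "(\<Sum>k<n. (- 1) ^ k * real (n choose Suc k) / real (Suc k)) = harm n"
proof (induction n)
  case 0
  show ?case by (simp add: harm_def)
next
  case (Suc n)
  have "(\<Sum>k<Suc n. (- 1) ^ k * real (Suc n choose Suc k) / real (Suc k)) =
      (\<Sum>k<Suc n. (- 1) ^ k * real (n choose Suc k) / real (Suc k)) +
      (\<Sum>k<Suc n. (- 1) ^ k * real (n choose k) / real (Suc k))"
    unfolding sum.distrib [symmetric]
    by (intro sum.cong) (simp_all add: algebra_simps add_divide_distrib)
  also have "(\<Sum>k<Suc n. (- 1) ^ k * real (n choose k) / real (Suc k)) =
      (\<Sum>k<Suc n. (- 1) ^ k * real (Suc n choose Suc k)) / real (Suc n)"
    unfolding sum_divide_distrib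
  proof (rule sum.cong)
    fix k
    have "real (Suc k) * real (Suc n choose Suc k) = real (Suc n) * real (n choose k)"
      by (simp only: Suc_times_binomial flip: of_nat_mult)
    hence "real (n choose k) / real (Suc k) = real (Suc n choose Suc k) / real (Suc n)"
      by (simp add: field_simps del: of_nat_Suc binomial_Suc_Suc)
    thus "(- 1) ^ k * real (n choose k) / real (Suc k) =
      (- 1) ^ k * real (Suc n choose Suc k) / real (Suc n)"
      by (simp only: times_divide_eq_right [symmetric])
  qed auto
  also have "(\<Sum>k<Suc n. (- 1) ^ k * real (Suc n choose Suc k)) = 1"
    using choose_alternating_sum[of "Suc n", where 'a = real]
    unfolding sum.atMost_Suc_shift
    by (simp add: lessThan_Suc_atMost sum_negf del: sum.atMost_Suc sum.lessThan_Suc binomial_Suc_Suc)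
  also have "(\<Sum>k<Suc n. (- 1) ^ k * real (n choose Suc k) / real (Suc k)) = harm n"
    by (simp add: binomial_eq_0 flip: Suc.IH)
  finally show ?case by (simp only: harm_Suc divide_inverse mult_1)
qed

lemma umbral_dual_hahn:
  "umbral gbern_even (dual_hahn n) = (fact n)\<^sup>2 * harm n / 2"
proof -
  have "umbral gbern_even (dual_hahn n) =
      (\<Sum>k\<le>n. (fact n)\<^sup>2 * real (n choose k) / (fact k)\<^sup>2 * umbral gbern_even (cfact 0 k))"
    by (simp add: dual_hahn_def umbral_sum umbral_smult)
  also have "\<dots> = (\<Sum>k<n. (fact n)\<^sup>2 * real (n choose Suc k) / (fact (Suc k))\<^sup>2 *
      ((- 1) ^ k * fact k * fact (Suc k) / 2))"
    \<comment> \<open>The term k = 0 drops out since \<open>gbern_even 0 = 0\<close>.\<close>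
    by (subst sum.atMost_shift) (simp add: umbral_gbern_cfact del: fact_Suc)
  also have "\<dots> = (fact n)\<^sup>2 / 2 * (\<Sum>k<n. (- 1) ^ k * real (n choose Suc k) / real (Suc k))"
    unfolding sum_distrib_left
    by (intro sum.cong) (simp_all add: power2_eq_square field_simps del: of_nat_Suc)
  finally show ?thesis unfolding harm_conv_alternating_sum by simp
qed

section \<open>Evaluation of the two Hankel determinants\<close>

lemma hankel_det_gbern':
  "hankel_det (\<lambda>k. gbern_even (Suc k)) n = (\<Prod>i<Suc n. (fact i) ^ 3 * fact (Suc i) / 2)"
proof -
  define A where "A = mat (n + 1) (n + 1)
    (\<lambda>(i, j). umbral (\<lambda>k. gbern_even (Suc k)) (dual_hahn i * cfact (Suc 0) j))"
  have "hankel_det (\<lambda>k. gbern_even (Suc k)) n = Determinant.det A"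
    unfolding A_def
    by (intro hankel_det_conv_umbral) (simp_all add: degree_dual_hahn coeff_dual_hahn_self)
  also have "\<dots> = prod_list (diag_mat A)"
    by (rule det_upper_triangular[of _ "n + 1"])
      (auto simp: A_def upper_triangular_def umbral_dual_hahn_mult)
  also have "\<dots> = (\<Prod>i<Suc n. (fact i) ^ 3 * fact (Suc i) / 2)"
    unfolding prod_list_diag_prod
    by (rule prod.cong) (auto simp: A_def umbral_dual_hahn_mult power2_eq_square power3_eq_cube)
  finally show ?thesis .
qed

lemma hankel_det_gbern:
  "hankel_det gbern_even n =
    (- 1) ^ n * ((fact n)\<^sup>2 * harm n / 2) * (\<Prod>i<n. (fact i) ^ 3 * fact (Suc i) / 2)"
proof -
  \<comment> \<open>All columns but the first carry a factor x, which shifts the moments by one and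
    makes the orthogonality relation applicable.\<close>
  define v where "v j = (case j of 0 \<Rightarrow> 1 | Suc j \<Rightarrow> pCons 0 (cfact (Suc 0) j))" for j
  define A where
    "A = mat (n + 1) (n + 1) (\<lambda>(i, j). umbral gbern_even (dual_hahn i * v j))"
  define B where "B = mat_delete A n 0"
  have A_0: "A $$ (n, 0) = (fact n)\<^sup>2 * harm n / 2"
    by (simp add: A_def v_def umbral_dual_hahn)
  have A_Suc: "A $$ (i, Suc j) =
      (- 1) ^ (i + j) * (fact i)\<^sup>2 * fact j * fact (Suc j) / 2 * real (j choose i)"
    if "i \<le> n" "j < n" for i j
    using that by (simp add: A_def v_def umbral_pCons umbral_dual_hahn_mult)
  have A: "A \<in> carrier_mat (n + 1) (n + 1)" and B: "B \<in> carrier_mat n n"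
    by (auto simp: A_def B_def mat_delete_def)
  have B_nth: "B $$ (i, j) = A $$ (i, Suc j)" if "i < n" "j < n" for i j
    using that A by (simp add: B_def mat_delete_def)
  have "degree (v i) \<le> i" "coeff (v i) i = 1" for i
    by (auto simp: v_def degree_pCons_eq_if split: nat.splits)
  hence "hankel_det gbern_even n = Determinant.det A"
    unfolding A_def
    by (intro hankel_det_conv_umbral) (simp_all add: degree_dual_hahn coeff_dual_hahn_self)
  also have "\<dots> = (\<Sum>j<n + 1. A $$ (n, j) * cofactor A n j)"
    by (rule laplace_expansion_row[OF A]) simp
  \<comment> \<open>In the last row, column j + 1 contains \<open>j choose n\<close> with j < n,
    which is 0.\<close>
  also have "\<dots> = A $$ (n, 0) * cofactor A n 0"
    by (simp add: sum.lessThan_Suc_shift A_Suc binomial_eq_0 del: sum.lessThan_Suc)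
  also have "cofactor A n 0 = (- 1) ^ n * Determinant.det B"
    by (simp add: cofactor_def B_def)
  \<comment> \<open>Deleting the last row and the first column realigns the indices, so
    \<open>j choose i\<close> makes \<open>B\<close> upper triangular.\<close>
  also have "Determinant.det B = prod_list (diag_mat B)"
    by (rule det_upper_triangular[OF _ B])
      (use B in \<open>auto simp: upper_triangular_def B_nth A_Suc\<close>)
  also have "\<dots> = (\<Prod>i<n. (fact i) ^ 3 * fact (Suc i) / 2)"
    unfolding prod_list_diag_prod using B
    by (intro prod.cong) (auto simp: B_nth A_Suc power2_eq_square power3_eq_cube)
  finally show ?thesis by (simp add: A_0)
qed

theorem proposition3p4:
  fixes n :: nat
  assumes "n \<ge> 1"
  shows "hankel_det (\<lambda>k. (2 ^ (2 * k) - 1) * bernoulli (2 * k)) n =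
    (- 1) ^ n / (fact n * fact (n + 1)) * harm n *
    hankel_det (\<lambda>k. (2 ^ (2 * k + 2) - 1) * bernoulli (2 * k + 2)) n"
proof -
  \<comment> \<open>The products differ by the single factor
    \<open>(fact n) ^ 3 * fact (Suc n) / 2\<close>; dividing \<open>(fact n)^2 / 2\<close> by it
    leaves the stated prefactor.\<close>
  have "hankel_det gbern_even n =
    (- 1) ^ n / (fact n * fact (n + 1)) * harm n * hankel_det (\<lambda>k. gbern_even (Suc k)) n"
    unfolding hankel_det_gbern hankel_det_gbern'
    by (simp add: power2_eq_square power3_eq_cube field_simps del: fact_Suc)
  thus ?thesis by (simp add: gbern_def gbern_even_def [abs_def])
qed

end
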